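(* Let $j\ge 4$ be an integer, and write $\rho_i=\rho_i(F_j,2)$ for the residue of $F_i^2$ modulo $F_j$ with $0\le\rho_i\le F_j-1$. (i) If $j=2t$ is even, then the sequence $\mathcal{F}^2(F_j)=(F_i^2 \bmod F_j: i\ge 0)$ has periodicity $j$ and the values of $\rho_i$ for $i\in\{0,\ldots,j-1\}$ are (i.1) $\rho_i=F_i^2$ if $i\in\{0,\ldots,t\}$; (i.2) $\rho_i=F_{j-i}^2$ if $i\in\{t+1,\ldots,j-1\}$. (ii) If $j=2t+1$ is odd, then $\mathcal{F}^2(F_j)$ has periodicity $2j$ and the values of $\rho_i$ for $i\in\{0,\ldots,2j-1\}$ are (ii.1) $\rho_i=F_i^2$ if $i\in\{0,\ldots,t+1\}$; (ii.2) $\rho_i=F_j-F_{j-i}^2$ if $i\in\{t+2,\ldots,j-1\}$; (ii.3) $\rho_i=0$ if $i=j$; (ii.4) $\rho_i=\rho_{2j-i}$ if $i\in\{j+1,\ldots,2j-1\}$.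
   Context: The Fibonacci numbers are $F_0=0$, $F_1=1$, $F_{i+1}=F_i+F_{i-1}$ for $i\ge 1$. For integers $j\ge 1$, $e\ge 1$, $\rho_i(F_j,e)$ is the integer with $\rho_i(F_j,e)\equiv F_i^e\pmod{F_j}$ and $0\le\rho_i(F_j,e)\le F_j-1$, and $\mathcal{F}^e(F_j)$ denotes the sequence $(F_i^e \bmod F_j: i\ge 0)$. A sequence $(a_i:i\ge 0)$ is periodic if there is an integer $p\ge 1$, called a period, with $a_{i+p}=a_i$ for all $i\ge 0$; its periodicity is its minimum period. *)

theory Defs
  imports "HOL-Number_Theory.Fib"
begin

(* For m > 0, int mod yields the residue in {0..m - 1}; the uses below have m = F_j with j >= 1. *)
definition fib_res :: "nat \<Rightarrow> int \<Rightarrow> nat \<Rightarrow> int" where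
  "fib_res i m e = int (fib i) ^ e mod m"

definition fib_res_seq :: "nat \<Rightarrow> int \<Rightarrow> nat \<Rightarrow> int" where
  "fib_res_seq e m = (\<lambda>i. fib_res i m e)"

definition is_period :: "(nat \<Rightarrow> 'a) \<Rightarrow> nat \<Rightarrow> bool" where
  "is_period a p \<longleftrightarrow> p \<ge> 1 \<and> (\<forall>i. a (i + p) = a i)"

(* A predicate rather than a LEAST-function, so that it is false for non-periodic sequences. *)
definition has_periodicity :: "(nat \<Rightarrow> 'a) \<Rightarrow> nat \<Rightarrow> bool" where
  "has_periodicity a p \<longleftrightarrow> is_period a p \<and> (\<forall>q. is_period a q \<longrightarrow> p \<le> q)"

end

theory Submission
  imports Defs "HOL-Number_Theory.Cong"
begin

text \<open>
  Modulo \<open>F_j\<close> the Fibonacci recurrence, run forwards and backwards from index \<open>j\<close>, gives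
  \<open>F_{j+i} \<equiv> F_{j-1} F_i\<close> and \<open>F_{j-i} \<equiv> (-1)^{i+1} F_{j-1} F_i\<close>, while Cassini's identity gives
  \<open>F_{j-1}^2 \<equiv> (-1)^j\<close>. Hence \<open>F_{j+i}^2 \<equiv> F_{j-i}^2 \<equiv> (-1)^j F_i^2\<close>. Since \<open>0 < F_i^2 < F_j\<close>
  for \<open>0 < 2 i \<le> j + 1\<close>, these congruences determine all residues, and \<open>F_j\<close> divides \<open>F_i^2\<close>
  only if \<open>j\<close> divides \<open>i\<close>, which bounds every period from below. For odd \<open>j\<close> the
  period \<open>j\<close> itself is excluded by comparing the residues at \<open>1\<close> and \<open>j + 1\<close>.
\<close>

text \<open>The addition formula splits \<open>fib j\<close> as F_{j-i+1} F_i + F_{j-i} F_{i-1}. The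
  bound on \<open>i\<close> says i <= j-i+1, so the first product is at least F_i^2, and the second
  is positive once i >= 2.\<close>

lemma fib_square_less:
  assumes "2 * i \<le> Suc j" and "3 \<le> j"
  shows "(fib i)\<^sup>2 < fib j"
proof (cases "i < 2")
  case True
  have "fib 3 \<le> fib j" using assms(2) by (rule fib_mono)
  moreover have "i = 0 \<or> i = 1" using True by auto
  ultimately show ?thesis by (auto simp: numeral_3_eq_3)
next
  case False
  have "(fib i)\<^sup>2 \<le> fib (Suc (j - i)) * fib i"
    using assms fib_mono[of i "Suc (j - i)"] by (simp add: power2_eq_square)
  also have "\<dots> < fib (Suc (j - i)) * fib i + fib (j - i) * fib (i - 1)"
    using False assms by (simp add: fib_neq_0_nat)
  also have "\<dots> = fib j"
    using fib_add[of "i - 1" "j - i"] False assms by simp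
  finally show ?thesis .
qed

text \<open>Putting F_{n+2} = F_{n+1} + F_n into Cassini's identity gives the quotient F_{n+1} - F_n
  explicitly. With j = n + 1 the sign is (-1)^j.\<close>

lemma fib_pred_square_cong:
  "[(int (fib n))\<^sup>2 = (- 1) ^ Suc n] (mod int (fib (Suc n)))"
proof -
  have "(int (fib n))\<^sup>2 - (- 1) ^ Suc n = int (fib (Suc n)) * (int (fib (Suc n)) - int (fib n))"
    using fib_Cassini_int[of n] by (simp add: power2_eq_square algebra_simps)
  then show ?thesis by (simp add: cong_iff_dvd_diff)
qed

lemma fib_add_cong:
  "[int (fib (Suc n + i)) = int (fib n) * int (fib i)] (mod int (fib (Suc n)))"
proof -
  have "int (fib (Suc n + i)) - int (fib n) * int (fib i) = int (fib (Suc n)) * int (fib (Suc i))"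
    using fib_add[of n i] by (simp add: algebra_simps flip: of_nat_mult of_nat_add)
  then show ?thesis by (simp add: cong_iff_dvd_diff)
qed

lemma fib_diff_cong:
  "i \<le> Suc n \<Longrightarrow>
    [int (fib (Suc n - i)) = (- 1) ^ Suc i * (int (fib n) * int (fib i))] (mod int (fib (Suc n)))"
proof (induction i rule: fib.induct)
  case 1
  then show ?case by (simp add: cong_0_iff)
next
  case 2
  then show ?case by simp
next
  case (3 i)
  \<comment> \<open>The index bound prevents truncation, so the recurrence can be solved for its
    lowest term; the subtraction makes the sign alternate.\<close>
  have "Suc n - i = Suc (Suc (Suc n - Suc (Suc i)))" and "Suc n - Suc i = Suc (Suc n - Suc (Suc i))"
    using 3(3) by auto
  then have rec: "int (fib (Suc n - Suc (Suc i))) = int (fib (Suc n - i)) - int (fib (Suc n - Suc i))"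
    by simp
  have "[int (fib (Suc n - i)) - int (fib (Suc n - Suc i)) =
      (- 1) ^ Suc i * (int (fib n) * int (fib i)) -
      (- 1) ^ Suc (Suc i) * (int (fib n) * int (fib (Suc i)))] (mod int (fib (Suc n)))"
    using 3 by (intro cong_diff) simp_all
  then show ?case unfolding rec by (simp add: algebra_simps)
qed

lemma fib_add_square_cong:
  assumes "0 < j"
  shows "[(int (fib (j + i)))\<^sup>2 = (- 1) ^ j * (int (fib i))\<^sup>2] (mod int (fib j))"
proof -
  obtain n where j: "j = Suc n" using assms gr0_conv_Suc by auto
  have "[(int (fib (j + i)))\<^sup>2 = (int (fib n))\<^sup>2 * (int (fib i))\<^sup>2] (mod int (fib j))"
    using cong_pow[OF fib_add_cong[of n i], of 2] unfolding j power_mult_distrib .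
  also have "[(int (fib n))\<^sup>2 * (int (fib i))\<^sup>2 = (- 1) ^ j * (int (fib i))\<^sup>2] (mod int (fib j))"
    unfolding j by (intro cong_mult fib_pred_square_cong cong_refl)
  finally show ?thesis .
qed

lemma fib_diff_square_cong:
  assumes "0 < j" and "i \<le> j"
  shows "[(int (fib (j - i)))\<^sup>2 = (- 1) ^ j * (int (fib i))\<^sup>2] (mod int (fib j))"
proof -
  obtain n where j: "j = Suc n" using assms(1) gr0_conv_Suc by auto
  have "[(int (fib (j - i)))\<^sup>2 = ((- 1) ^ Suc i * (int (fib n) * int (fib i)))\<^sup>2] (mod int (fib j))"
    using cong_pow[OF fib_diff_cong[of i n], of 2] assms(2) unfolding j by blast
  \<comment> \<open>Squaring removes the sign depending on \<open>i\<close>; only Cassini's sign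
    (-1)^j survives.\<close>
  also have "((- 1) ^ Suc i * (int (fib n) * int (fib i)))\<^sup>2 = (int (fib n))\<^sup>2 * (int (fib i))\<^sup>2"
    by (simp add: power_mult_distrib flip: power_mult)
  also have "[\<dots> = (- 1) ^ j * (int (fib i))\<^sup>2] (mod int (fib j))"
    unfolding j by (intro cong_mult fib_pred_square_cong cong_refl)
  finally show ?thesis .
qed

lemma fib_square_mod_low:
  assumes "2 * i \<le> Suc j" and "3 \<le> j"
  shows "(int (fib i))\<^sup>2 mod int (fib j) = (int (fib i))\<^sup>2"
  using fib_square_less[OF assms] by (simp flip: of_nat_power)

lemma fib_square_mod_even:
  assumes "even j" and "3 \<le> j" and "i \<le> j" and "j \<le> 2 * i"
  shows "(int (fib i))\<^sup>2 mod int (fib j) = (int (fib (j - i)))\<^sup>2"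
proof -
  have "(int (fib i))\<^sup>2 mod int (fib j) = (int (fib (j - i)))\<^sup>2 mod int (fib j)"
    using fib_diff_square_cong[of j i] assms by (simp add: cong_def)
  also have "\<dots> = (int (fib (j - i)))\<^sup>2"
    using assms by (intro fib_square_mod_low) auto
  finally show ?thesis .
qed

text \<open>For odd \<open>j\<close> reflection negates the square. Adding \<open>fib j\<close> once
  reaches the residue range, since 0 < F_{j-i}^2 < F_j; the left inequality uses i < j.\<close>

lemma fib_square_mod_odd:
  assumes "odd j" and "3 \<le> j" and "i < j" and "j \<le> 2 * i + 1"
  shows "(int (fib i))\<^sup>2 mod int (fib j) = int (fib j) - (int (fib (j - i)))\<^sup>2"
proof -
  have "int (fib j) dvd (int (fib (j - i)))\<^sup>2 + (int (fib i))\<^sup>2"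
    using fib_diff_square_cong[of j i] assms by (simp add: cong_iff_dvd_diff)
  then have "int (fib j) dvd (int (fib i))\<^sup>2 - (int (fib j) - (int (fib (j - i)))\<^sup>2)"
    by (metis (no_types, opaque_lifting) add.commute diff_diff_eq2 dvd_diff dvd_refl)
  then have "(int (fib i))\<^sup>2 mod int (fib j) =
      (int (fib j) - (int (fib (j - i)))\<^sup>2) mod int (fib j)"
    by (simp only: mod_eq_dvd_iff)
  also have "\<dots> = int (fib j) - (int (fib (j - i)))\<^sup>2"
  proof (rule mod_pos_pos_trivial)
    have "(fib (j - i))\<^sup>2 < fib j" using assms by (intro fib_square_less) auto
    then show "0 \<le> int (fib j) - (int (fib (j - i)))\<^sup>2" by (simp flip: of_nat_power)
    show "int (fib j) - (int (fib (j - i)))\<^sup>2 < int (fib j)"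
      using assms by (simp add: fib_neq_0_nat)
  qed
  finally show ?thesis .
qed

text \<open>Both squares are congruent to (-1)^j F_i^2, so the parity of \<open>j\<close> does not
  matter.\<close>

lemma fib_square_mod_mirror:
  assumes "i \<le> j" and "0 < j"
  shows "(int (fib (j + i)))\<^sup>2 mod int (fib j) = (int (fib (j - i)))\<^sup>2 mod int (fib j)"
  using cong_trans[OF fib_add_square_cong[OF assms(2)]
      cong_sym[OF fib_diff_square_cong[OF assms(2,1)]]]
  by (simp add: cong_def)

lemma fib_square_mod_pos:
  assumes "0 < i" and "i < j" and "3 \<le> j"
  shows "0 < (int (fib i))\<^sup>2 mod int (fib j)"
proof (cases "2 * i \<le> Suc j")
  case True
  then show ?thesis using assms by (simp add: fib_square_mod_low fib_neq_0_nat)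
next
  case False
  have "(fib (j - i))\<^sup>2 < fib j" using False assms by (intro fib_square_less) auto
  then have "(int (fib (j - i)))\<^sup>2 < int (fib j)" by (simp flip: of_nat_power)
  then show ?thesis using False assms
    by (cases "even j") (simp_all add: fib_square_mod_even fib_square_mod_odd fib_neq_0_nat)
qed

text \<open>A period \<open>q\<close> forces the residue at \<open>q\<close> to equal the one at 0,
  which is 0, whereas indices strictly between 0 and \<open>j\<close> have positive
  residues.\<close>

lemma fib_res_seq_period_ge:
  assumes "3 \<le> j" and "is_period (fib_res_seq 2 (int (fib j))) q"
  shows "j \<le> q"
proof (rule ccontr)
  assume "\<not> j \<le> q"
  then have "0 < (int (fib q))\<^sup>2 mod int (fib j)"
    using assms by (intro fib_square_mod_pos) (auto simp: is_period_def)
  moreover have "(int (fib (0 + q)))\<^sup>2 mod int (fib j) = (int (fib 0))\<^sup>2 mod int (fib j)"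
    using assms(2) unfolding is_period_def fib_res_seq_def fib_res_def by blast
  ultimately show False by simp
qed

lemma fib_res_seq_periodicity_even:
  assumes "even j" and "3 \<le> j"
  shows "has_periodicity (fib_res_seq 2 (int (fib j))) j"
  unfolding has_periodicity_def
proof (intro conjI allI impI)
  have "(int (fib (i + j)))\<^sup>2 mod int (fib j) = (int (fib i))\<^sup>2 mod int (fib j)" for i
    using fib_add_square_cong[of j i] assms by (simp add: cong_def add.commute)
  then show "is_period (fib_res_seq 2 (int (fib j))) j"
    using assms by (simp add: is_period_def fib_res_seq_def fib_res_def)
qed (rule fib_res_seq_period_ge[OF assms(2)])

text \<open>The bound excludes j = 3: modulo F_3 = 2 signs are invisible and 3 is already a
  period.\<close>

lemma fib_res_seq_periodicity_odd:
  assumes "odd j" and "5 \<le> j"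
  shows "has_periodicity (fib_res_seq 2 (int (fib j))) (2 * j)"
  unfolding has_periodicity_def
proof (intro conjI allI impI)
  have shift: "[(int (fib (j + i)))\<^sup>2 = - ((int (fib i))\<^sup>2)] (mod int (fib j))" for i
    using fib_add_square_cong[of j i] assms by simp
  have "[(int (fib (i + 2 * j)))\<^sup>2 = (int (fib i))\<^sup>2] (mod int (fib j))" for i
  proof -
    \<comment> \<open>Each shift by \<open>j\<close> negates the square, so two shifts restore
      it.\<close>
    have "[(int (fib (j + (j + i))))\<^sup>2 = - (- ((int (fib i))\<^sup>2))] (mod int (fib j))"
      using cong_trans[OF shift] shift[of i] cong_minus_minus_iff by blast
    then show ?thesis by (simp only: mult_2 add.commute add.left_commute minus_minus)
  qed
  then show "is_period (fib_res_seq 2 (int (fib j))) (2 * j)"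
    using assms by (simp add: is_period_def fib_res_seq_def fib_res_def cong_def)
next
  fix q
  assume q: "is_period (fib_res_seq 2 (int (fib j))) q"
  then have per: "(int (fib (i + q)))\<^sup>2 mod int (fib j) = (int (fib i))\<^sup>2 mod int (fib j)" for i
    unfolding is_period_def fib_res_seq_def fib_res_def by blast
  have "j \<le> q" using fib_res_seq_period_ge[OF _ q] assms by simp
  show "2 * j \<le> q"
  proof (rule ccontr)
    assume "\<not> 2 * j \<le> q"
    show False
    proof (cases "q = j")
      case True
      \<comment> \<open>The residue at j + 1 mirrors to the one at j - 1, namely F_j - 1. Equality
        with the residue 1 at index 1 would give F_j = 2, but F_j >= F_5 = 5.\<close>
      have "(int (fib 1))\<^sup>2 mod int (fib j) = (int (fib (j - 1)))\<^sup>2 mod int (fib j)"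
        using per[of 1] fib_square_mod_mirror[of 1 j] assms True by (simp add: add.commute)
      moreover have "(int (fib 1))\<^sup>2 mod int (fib j) = (int (fib 1))\<^sup>2"
        using assms by (intro fib_square_mod_low) auto
      moreover have "(int (fib (j - 1)))\<^sup>2 mod int (fib j) = int (fib j) - (int (fib (j - (j - 1))))\<^sup>2"
        using assms by (intro fib_square_mod_odd) auto
      moreover have "fib 5 \<le> fib j" using assms(2) by (rule fib_mono)
      ultimately show False using assms by (simp add: eval_nat_numeral)
    next
      case False
      define i where "i = q - j"
      have i: "q = j + i" "0 < i" "i < j"
        using False \<open>j \<le> q\<close> \<open>\<not> 2 * j \<le> q\<close> by (auto simp: i_def)
      \<comment> \<open>The residue at \<open>q\<close> is the one at j - i by mirroring, hence
        positive, while periodicity from index 0 makes it 0.\<close>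
      have "0 < (int (fib (j - i)))\<^sup>2 mod int (fib j)"
        using i assms by (intro fib_square_mod_pos) auto
      then show False
        using per[of 0] fib_square_mod_mirror[of i j] i by simp
    qed
  qed
qed

theorem theorem3:
  fixes j t :: nat and \<rho> :: "nat \<Rightarrow> int"
  assumes "j \<ge> 4"
    and "\<And>i. \<rho> i = fib_res i (int (fib j)) 2"
  shows "(j = 2 * t \<longrightarrow>
            has_periodicity (fib_res_seq 2 (int (fib j))) j \<and>
            (\<forall>i\<in>{0..t}. \<rho> i = int (fib i) ^ 2) \<and>
            (\<forall>i\<in>{t + 1..j - 1}. \<rho> i = int (fib (j - i)) ^ 2)) \<and>
         (j = 2 * t + 1 \<longrightarrow>
            has_periodicity (fib_res_seq 2 (int (fib j))) (2 * j) \<and>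
            (\<forall>i\<in>{0..t + 1}. \<rho> i = int (fib i) ^ 2) \<and>
            (\<forall>i\<in>{t + 2..j - 1}. \<rho> i = int (fib j) - int (fib (j - i)) ^ 2) \<and>
            \<rho> j = 0 \<and>
            (\<forall>i\<in>{j + 1..2 * j - 1}. \<rho> i = \<rho> (2 * j - i)))"
proof (intro conjI impI ballI)
  assume j: "j = 2 * t"
  show "has_periodicity (fib_res_seq 2 (int (fib j))) j"
    using assms(1) j by (intro fib_res_seq_periodicity_even) auto
  show "\<rho> i = int (fib i) ^ 2" if "i \<in> {0..t}" for i
    unfolding assms(2) fib_res_def using that assms(1) j by (intro fib_square_mod_low) auto
  show "\<rho> i = int (fib (j - i)) ^ 2" if "i \<in> {t + 1..j - 1}" for i
    unfolding assms(2) fib_res_def using that assms(1) j by (intro fib_square_mod_even) auto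
next
  assume j: "j = 2 * t + 1"
  show "has_periodicity (fib_res_seq 2 (int (fib j))) (2 * j)"
    using assms(1) j by (intro fib_res_seq_periodicity_odd) auto
  \<comment> \<open>At i = t + 1 the bound 2 i <= j + 1 of \<open>fib_square_mod_low\<close> is
    attained.\<close>
  show "\<rho> i = int (fib i) ^ 2" if "i \<in> {0..t + 1}" for i
    unfolding assms(2) fib_res_def using that assms(1) j by (intro fib_square_mod_low) auto
  show "\<rho> i = int (fib j) - int (fib (j - i)) ^ 2" if "i \<in> {t + 2..j - 1}" for i
    unfolding assms(2) fib_res_def using that assms(1) j by (intro fib_square_mod_odd) auto
  show "\<rho> j = 0"
    by (simp add: assms(2) fib_res_def)
  show "\<rho> i = \<rho> (2 * j - i)" if "i \<in> {j + 1..2 * j - 1}" for i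
  proof -
    have "j + (i - j) = i" "j - (i - j) = 2 * j - i" "i - j \<le> j" "0 < j"
      using that by auto
    then show ?thesis
      unfolding assms(2) fib_res_def using fib_square_mod_mirror[of "i - j" j] by simp
  qed
qed

end
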